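(* Let $\Omega\subseteq\mathbb{R}^d$ be open, and let $p(\cdot)\in\mathcal{P}$ with $p_+<\infty$ and $p(\cdot)\in LH_0$. If there exists $x_0\in\Omega$ such that $p(x_0)=p_-$, then there exists $\varepsilon>0$ such that $$\mathcal{E}_{\mathsf G}^{L_{p(\cdot)}}(t)\sim t^{-1/p_-},\qquad 0<t<\varepsilon,$$ i.e. there are constants $A,B>0$ with $A\,t^{-1/p_-}\le\mathcal{E}_{\mathsf G}^{L_{p(\cdot)}}(t)\le B\,t^{-1/p_-}$ for all $0<t<\varepsilon$.
   Context: $\mu$ is Lebesgue measure on $\Omega$. For a measurable $p(\cdot):\Omega\to(0,\infty)$ put $p_-=\operatorname{ess\,inf}_{x\in\Omega}p(x)$, $p_+=\operatorname{ess\,sup}_{x\in\Omega}p(x)$. $\mathcal{P}$ is the set of such functions with $p_->0$ (exponent functions). Log-Hölder continuity: $r(\cdot)\in LH_0\{x_0\}$ (locally log-Hölder continuous at $x_0\in\Omega$) if there is $C_0>0$ with $|r(x)-r(x_0)|\le\frac{C_0}{-\log(|x-x_0|)}$ for all $x\in\Omega$ with $|x-x_0|<1/2$. $r(\cdot)\in LH_0$ if this holds for all $x_0\in\Omega$. Variable Lebesgue space $L_{p(\cdot)}=L_{p(\cdot)}(\Omega)$: with $\varrho_{p(\cdot)}(f)=\int_\Omega|f(x)|^{p(x)}\,dx$, it consists of the measurable $f$ with $\varrho_{p(\cdot)}(f/\lambda)<\infty$ for some $\lambda>0$, with quasi-norm $\|f\|_{p(\cdot)}=\inf\{\lambda>0:\varrho_{p(\cdot)}(f/\lambda)\le1\}$.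 Rearrangement: $f^*(t)=\inf\{s>0:\mu(\{|f|>s\})\le t\}$, $t\ge0$ (with $\inf\emptyset=\infty$). Growth envelope function of a quasi-normed function space $X$ on $\Omega$: $\mathcal{E}_{\mathsf G}^X(t)=\sup\{f^*(t):\|f\|_X\le1\}$, $t>0$. *)

theory Defs
  imports "HOL-Analysis.Analysis" "HOL-Probability.Essential_Supremum"
begin

text \<open>
  Throughout, \<open>\<Omega>\<close> carries Lebesgue measure \<^term>\<open>lebesgue_on \<Omega>\<close>; functions on \<open>\<Omega>\<close> are total
  functions whose values outside \<open>\<Omega>\<close> are irrelevant.
\<close>

definition p_minus :: "(real ^ 'd) set \<Rightarrow> (real ^ 'd \<Rightarrow> real) \<Rightarrow> ereal" where
  "p_minus \<Omega> p = - esssup (lebesgue_on \<Omega>) (\<lambda>x. - ereal (p x))"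

definition p_plus :: "(real ^ 'd) set \<Rightarrow> (real ^ 'd \<Rightarrow> real) \<Rightarrow> ereal" where
  "p_plus \<Omega> p = esssup (lebesgue_on \<Omega>) (\<lambda>x. ereal (p x))"

definition exponent_functions :: "(real ^ 'd) set \<Rightarrow> (real ^ 'd \<Rightarrow> real) set" where
  "exponent_functions \<Omega> =
     {p \<in> borel_measurable (lebesgue_on \<Omega>). (\<forall>x\<in>\<Omega>. 0 < p x) \<and> 0 < p_minus \<Omega> p}"

text \<open>
  At \<open>x = x0\<close> the bound reads \<open>0 \<le> C0 / - ln 0\<close>, which holds because \<open>ln 0 = 0\<close> and
  \<open>C0 / 0 = 0\<close>; this agrees with the usual convention \<open>1 / \<infinity> = 0\<close>.
\<close>

definition LH0_at :: "(real ^ 'd) set \<Rightarrow> real ^ 'd \<Rightarrow> (real ^ 'd \<Rightarrow> real) set" where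
  "LH0_at \<Omega> x0 = {r. \<exists>C0>0. \<forall>x\<in>\<Omega>. norm (x - x0) < 1/2 \<longrightarrow>
     \<bar>r x - r x0\<bar> \<le> C0 / (- ln (norm (x - x0)))}"

definition LH0 :: "(real ^ 'd) set \<Rightarrow> (real ^ 'd \<Rightarrow> real) set" where
  "LH0 \<Omega> = {r. \<forall>x0\<in>\<Omega>. r \<in> LH0_at \<Omega> x0}"

definition var_modular ::
    "(real ^ 'd) set \<Rightarrow> (real ^ 'd \<Rightarrow> real) \<Rightarrow> (real ^ 'd \<Rightarrow> real) \<Rightarrow> ennreal" where
  "var_modular \<Omega> p f = (\<integral>\<^sup>+x. ennreal (\<bar>f x\<bar> powr p x) \<partial>lebesgue_on \<Omega>)"

definition var_Lebesgue ::
    "(real ^ 'd) set \<Rightarrow> (real ^ 'd \<Rightarrow> real) \<Rightarrow> (real ^ 'd \<Rightarrow> real) set" where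
  "var_Lebesgue \<Omega> p = {f \<in> borel_measurable (lebesgue_on \<Omega>).
     \<exists>c::real. c > 0 \<and> var_modular \<Omega> p (\<lambda>x. f x / c) < \<infinity>}"

text \<open>Quasi-norms take values in \<^typ>\<open>ennreal\<close>, so that the infimum of the empty set is \<open>\<infinity>\<close>.\<close>

definition var_norm ::
    "(real ^ 'd) set \<Rightarrow> (real ^ 'd \<Rightarrow> real) \<Rightarrow> (real ^ 'd \<Rightarrow> real) \<Rightarrow> ennreal" where
  "var_norm \<Omega> p f =
     Inf {ennreal c |c. c > 0 \<and> var_modular \<Omega> p (\<lambda>x. f x / c) \<le> 1}"

definition rearrangement ::
    "(real ^ 'd) set \<Rightarrow> (real ^ 'd \<Rightarrow> real) \<Rightarrow> real \<Rightarrow> ennreal" where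
  "rearrangement \<Omega> f t =
     Inf {ennreal s |s. s > 0 \<and> emeasure (lebesgue_on \<Omega>) {x \<in> \<Omega>. \<bar>f x\<bar> > s} \<le> ennreal t}"

text \<open>A function space is given by its carrier \<open>X\<close> together with its quasi-norm \<open>N\<close>.\<close>

definition growth_envelope ::
    "(real ^ 'd) set \<Rightarrow> (real ^ 'd \<Rightarrow> real) set \<Rightarrow> ((real ^ 'd \<Rightarrow> real) \<Rightarrow> ennreal)
      \<Rightarrow> real \<Rightarrow> ennreal" where
  "growth_envelope \<Omega> X N t = (SUP f \<in> {f \<in> X. N f \<le> 1}. rearrangement \<Omega> f t)"

end

(* Upper bound: p >= p_- almost everywhere, so Markov's inequality for the modular gives a
   weak-type estimate with exponent p_- at levels above 1. Lower bound: test with a multiple of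
   r^(-d/p_-) times the indicator of ball x0 r, where r^d is comparable to t. On this ball
   p exceeds p_- by at most C0 / (- ln r), and r^(- 1 / (- ln r)) = e, so replacing p by p_- in the
   modular costs only a constant factor. *)

theory Submission
  imports Defs
begin

section \<open>Essential infimum, modular and quasi-norm\<close>

lemma AE_p_minus_le:
  assumes "p \<in> borel_measurable (lebesgue_on \<Omega>)" "p_minus \<Omega> p = ereal q"
  shows "AE x in lebesgue_on \<Omega>. q \<le> p x"
proof -
  have "AE x in lebesgue_on \<Omega>. - ereal (p x) \<le> esssup (lebesgue_on \<Omega>) (\<lambda>x. - ereal (p x))"
    by (rule esssup_AE)
  moreover have "esssup (lebesgue_on \<Omega>) (\<lambda>x. - ereal (p x)) = ereal (- q)"
    using assms(2) unfolding p_minus_def by (metis ereal_uminus_uminus uminus_ereal.simps(1))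
  ultimately show ?thesis
    by simp
qed

lemma var_modular_scale_antimono:
  assumes "\<And>x. x \<in> \<Omega> \<Longrightarrow> 0 < p x" "0 < c" "c \<le> c'"
  shows "var_modular \<Omega> p (\<lambda>x. f x / c') \<le> var_modular \<Omega> p (\<lambda>x. f x / c)"
  unfolding var_modular_def
proof (rule nn_integral_mono)
  fix x assume "x \<in> space (lebesgue_on \<Omega>)"
  then have "x \<in> \<Omega>" by simp
  moreover have "\<bar>f x / c'\<bar> \<le> \<bar>f x / c\<bar>"
    using assms(2,3) by (auto simp: abs_divide intro!: divide_left_mono)
  ultimately show "ennreal (\<bar>f x / c'\<bar> powr p x) \<le> ennreal (\<bar>f x / c\<bar> powr p x)"
    using assms(1) by (intro ennreal_leI powr_mono2) (auto simp: less_imp_le)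
qed

text \<open>The strict inequality avoids asking whether the infimum is attained: it yields an
  admissible scale below \<open>c\<close>, and enlarging the scale only decreases the
  modular.\<close>

lemma var_modular_le_1_if_var_norm_less:
  assumes "\<And>x. x \<in> \<Omega> \<Longrightarrow> 0 < p x" "var_norm \<Omega> p f < ennreal c"
  shows "var_modular \<Omega> p (\<lambda>x. f x / c) \<le> 1"
proof -
  obtain c' where c': "c' > 0" "var_modular \<Omega> p (\<lambda>x. f x / c') \<le> 1" "ennreal c' < ennreal c"
    using assms(2) unfolding var_norm_def Inf_less_iff by blast
  then have "c' \<le> c"
    by (metis ennreal_less_iff less_imp_le)
  then have "var_modular \<Omega> p (\<lambda>x. f x / c) \<le> var_modular \<Omega> p (\<lambda>x. f x / c')"
    using assms(1) c'(1) by (intro var_modular_scale_antimono)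
  also note c'(2)
  finally show ?thesis .
qed

text \<open>Markov's inequality shows that the level \<open>c * t powr (- 1 / q)\<close> is
  admissible in the infimum defining the rearrangement.\<close>

lemma rearrangement_le_if_var_modular_le_1:
  assumes \<Omega>: "\<Omega> \<in> sets lebesgue"
    and p[measurable]: "p \<in> borel_measurable (lebesgue_on \<Omega>)"
    and f[measurable]: "f \<in> borel_measurable (lebesgue_on \<Omega>)"
    and q: "0 < q" "AE x in lebesgue_on \<Omega>. q \<le> p x"
    and c: "0 < c" "var_modular \<Omega> p (\<lambda>x. f x / c) \<le> 1"
    and t: "0 < t" "t \<le> 1"
  shows "rearrangement \<Omega> f t \<le> ennreal (c * t powr (- 1 / q))"
proof -
  define s where "s = t powr (- 1 / q)"
  \<comment> \<open>Here \<open>t \<le> 1\<close> enters. Since the base is at least 1, the exponent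
    \<open>q\<close> may be replaced by the larger \<open>p x\<close> in the lower bound on
    \<open>E\<close>.\<close>
  have s: "s \<ge> 1"
    using t q powr_mono2'[of "- 1 / q" t 1] by (simp add: s_def)
  have sq: "t * s powr q = 1"
    using t q by (simp add: s_def powr_powr powr_neg_one)
  define E where "E = {x \<in> \<Omega>. \<bar>f x\<bar> > c * s}"
  have "{x \<in> space (lebesgue_on \<Omega>). \<bar>f x\<bar> > c * s} \<in> sets (lebesgue_on \<Omega>)"
    by measurable
  then have E[measurable]: "E \<in> sets (lebesgue_on \<Omega>)"
    by (simp add: E_def)
  have "emeasure (lebesgue_on \<Omega>) E = (\<integral>\<^sup>+x. indicator E x \<partial>lebesgue_on \<Omega>)"
    by simp
  also have "\<dots> \<le> (\<integral>\<^sup>+x. ennreal t * ennreal (\<bar>f x / c\<bar> powr p x) \<partial>lebesgue_on \<Omega>)"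
  proof (rule nn_integral_mono_AE, use q(2) in eventually_elim)
    fix x assume qp: "q \<le> p x"
    show "indicator E x \<le> ennreal t * ennreal (\<bar>f x / c\<bar> powr p x)"
    proof (cases "x \<in> E")
      case True
      then have "s \<le> \<bar>f x / c\<bar>"
        using c by (auto simp: E_def abs_divide field_simps)
      then have "s powr q \<le> \<bar>f x / c\<bar> powr p x"
        using s q qp by (intro powr_mono_both) auto
      then have "1 \<le> t * \<bar>f x / c\<bar> powr p x"
        using t sq by (metis mult_le_cancel_left_pos)
      then show ?thesis
        using True t by (simp flip: ennreal_mult add: ennreal_ge_1)
    qed simp
  qed
  also have "\<dots> = ennreal t * var_modular \<Omega> p (\<lambda>x. f x / c)"
    unfolding var_modular_def by (rule nn_integral_cmult) measurable
  also have "\<dots> \<le> ennreal t"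
    using mult_left_mono[OF c(2), of "ennreal t"] by simp
  finally have "emeasure (lebesgue_on \<Omega>) {x \<in> \<Omega>. \<bar>f x\<bar> > c * s} \<le> ennreal t"
    unfolding E_def .
  then show ?thesis
    unfolding rearrangement_def s_def[symmetric] using c s
    by (intro Inf_lower) (auto intro!: exI[of _ "c * s"])
qed

section \<open>Rearrangement and modular of scaled indicators\<close>

lemma le_rearrangement_indicator:
  assumes "0 < a" "ennreal t < emeasure (lebesgue_on \<Omega>) B" "B \<subseteq> \<Omega>"
  shows "ennreal a \<le> rearrangement \<Omega> (\<lambda>x. a * indicator B x) t"
  unfolding rearrangement_def
proof (rule Inf_greatest, clarify)
  fix s :: real
  assume s: "s > 0"
    and le: "emeasure (lebesgue_on \<Omega>) {x \<in> \<Omega>. \<bar>a * indicator B x\<bar> > s} \<le> ennreal t"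
  \<comment> \<open>A level \<open>s\<close> with \<open>0 < s < a\<close> has exactly
    \<open>B\<close> as its superlevel set, and \<open>B\<close> is too large for \<open>s\<close>
    to be admissible.\<close>
  show "ennreal a \<le> ennreal s"
  proof (rule ccontr)
    assume "\<not> ennreal a \<le> ennreal s"
    then have "s < a"
      by (meson ennreal_leI not_le)
    then have "{x \<in> \<Omega>. \<bar>a * indicator B x\<bar> > s} = B"
      using assms(1,3) s by (auto simp: indicator_def)
    with le assms(2) show False
      by simp
  qed
qed

text \<open>The excess exponent \<open>C / (- ln r)\<close> contributes only the factor
  \<open>exp (C * \<delta> / q)\<close>, because \<open>ln r\<close> cancels. The base is split into
  two factors that are monotone in opposite directions: \<open>r powr (- \<delta> / q)\<close> is at
  least 1 and \<open>A\<close> is at most 1.\<close>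

lemma powr_LH0_exponent_bound:
  fixes A C p q r \<delta> :: real
  assumes C: "0 \<le> C" and q: "0 < q" and \<delta>: "0 \<le> \<delta>" and r: "0 < r" "r < 1"
    and A: "0 < A" "A \<le> 1" and pq: "q \<le> p" "p \<le> q + C / (- ln r)"
  shows "(A * r powr (- \<delta> / q)) powr p \<le> A powr q * (r powr (- \<delta>) * exp (C * \<delta> / q))"
proof -
  let ?b = "r powr (- \<delta> / q)"
  have b: "?b \<ge> 1"
    using powr_mono2'[of "- \<delta> / q" r 1] r \<delta> q by simp
  have "?b powr p \<le> ?b powr (q + C / (- ln r))"
    using b pq by (intro powr_mono) auto
  also have "\<dots> = r powr (- \<delta>) * exp (C * \<delta> / q)"
  proof -
    have "ln r < 0" using r by simp
    then show ?thesis
      using r q by (simp add: powr_def field_simps flip: exp_add)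
  qed
  finally have "?b powr p \<le> r powr (- \<delta>) * exp (C * \<delta> / q)" .
  moreover have "A powr p \<le> A powr q"
    using A pq by (intro powr_mono') auto
  ultimately show ?thesis
    using A by (simp add: powr_mult mult_mono)
qed

text \<open>The pointwise bound carries \<open>r powr (- \<delta>)\<close> and the volume of the
  ball carries \<open>r powr \<delta>\<close>. They cancel, so the bound does not depend on
  \<open>r\<close> and one \<open>A\<close> serves all small radii.\<close>

lemma var_modular_ball_le:
  fixes \<Omega> :: "(real ^ 'd) set" and \<delta> :: real
  defines "\<delta> \<equiv> real DIM(real ^ 'd)"
  assumes \<Omega>: "\<Omega> \<in> sets lebesgue" and ball: "ball x0 r \<subseteq> \<Omega>"
    and p: "AE x in lebesgue_on \<Omega>. q \<le> p x" and q: "p x0 = q" "0 < q"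
    and C: "0 < C" "\<And>x. x \<in> \<Omega> \<Longrightarrow> norm (x - x0) < 1/2 \<Longrightarrow> \<bar>p x - p x0\<bar> \<le> C / (- ln (norm (x - x0)))"
    and r: "0 < r" "r < 1/2" and A: "0 < A" "A \<le> 1"
  shows "var_modular \<Omega> p (\<lambda>x. A * r powr (- \<delta> / q) * indicator (ball x0 r) x)
    \<le> ennreal (A powr q * (unit_ball_vol \<delta> * exp (C * \<delta> / q)))"
proof -
  let ?M = "A powr q * (r powr (- \<delta>) * exp (C * \<delta> / q))"
  have "var_modular \<Omega> p (\<lambda>x. A * r powr (- \<delta> / q) * indicator (ball x0 r) x)
    \<le> (\<integral>\<^sup>+x. ennreal ?M * indicator (ball x0 r) x \<partial>lebesgue_on \<Omega>)"
    unfolding var_modular_def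
  proof (rule nn_integral_mono_AE, use p in eventually_elim)
    fix x assume qp: "q \<le> p x"
    show "ennreal (\<bar>A * r powr (- \<delta> / q) * indicator (ball x0 r) x\<bar> powr p x)
      \<le> ennreal ?M * indicator (ball x0 r) x"
    proof (cases "x \<in> ball x0 r")
      case True
      then have nr: "norm (x - x0) < r"
        by (simp add: dist_norm norm_minus_commute)
      have "p x \<le> q + C / (- ln r)"
      proof (cases "x = x0")
        case True
        have "C / (- ln r) \<ge> 0"
          using r C by (intro divide_nonneg_nonneg) auto
        then show ?thesis
          using True q by simp
      next
        case False
        then have n0: "norm (x - x0) > 0"
          by simp
        have "C / (- ln (norm (x - x0))) \<le> C / (- ln r)"
          using nr n0 r C by (intro divide_left_mono mult_pos_pos) auto
        moreover have "\<bar>p x - p x0\<bar> \<le> C / (- ln (norm (x - x0)))"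
          using True nr r ball by (intro C(2)) auto
        ultimately show ?thesis
          using q by linarith
      qed
      then have "(A * r powr (- \<delta> / q)) powr p x \<le> ?M"
        using C(1) q r A qp by (intro powr_LH0_exponent_bound) (auto simp: \<delta>_def)
      then show ?thesis
        using True A r by (simp add: ennreal_leI)
    qed (use q qp in simp)
  qed
  also have "\<dots> = ennreal ?M * emeasure (lebesgue_on \<Omega>) (ball x0 r)"
    using ball \<Omega> by (intro nn_integral_cmult_indicator) (auto simp: sets_restrict_space_iff)
  also have "emeasure (lebesgue_on \<Omega>) (ball x0 r) = ennreal (unit_ball_vol \<delta> * r powr \<delta>)"
    using ball \<Omega> r
    by (simp add: emeasure_restrict_space emeasure_ball \<delta>_def powr_realpow del: DIM_cart)
  also have "ennreal ?M * \<dots> = ennreal (?M * (unit_ball_vol \<delta> * r powr \<delta>))"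
    using A by (intro ennreal_mult[symmetric]) (auto simp: \<delta>_def)
  also have "?M * (unit_ball_vol \<delta> * r powr \<delta>) = A powr q * (unit_ball_vol \<delta> * exp (C * \<delta> / q))"
    using r by (simp add: powr_minus field_simps)
  finally show ?thesis .
qed

section \<open>Upper and lower estimates of the growth envelope\<close>

lemma growth_envelope_var_Lebesgue_le:
  assumes \<Omega>: "\<Omega> \<in> sets lebesgue"
    and p: "p \<in> borel_measurable (lebesgue_on \<Omega>)" "\<And>x. x \<in> \<Omega> \<Longrightarrow> 0 < p x"
    and q: "0 < q" "AE x in lebesgue_on \<Omega>. q \<le> p x"
    and t: "0 < t" "t \<le> 1"
  shows "growth_envelope \<Omega> (var_Lebesgue \<Omega> p) (var_norm \<Omega> p) t \<le> ennreal (2 * t powr (- 1 / q))"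
  unfolding growth_envelope_def
proof (rule SUP_least)
  fix f assume "f \<in> {f \<in> var_Lebesgue \<Omega> p. var_norm \<Omega> p f \<le> 1}"
  then have f: "f \<in> borel_measurable (lebesgue_on \<Omega>)" and "var_norm \<Omega> p f \<le> 1"
    by (auto simp: var_Lebesgue_def)
  \<comment> \<open>Any constant above 1 would do in place of 2; it provides the strict inequality
    needed to pass to the modular.\<close>
  then have "var_norm \<Omega> p f < ennreal 2"
    by (rule_tac le_less_trans) auto
  then have "var_modular \<Omega> p (\<lambda>x. f x / 2) \<le> 1"
    using p(2) by (intro var_modular_le_1_if_var_norm_less)
  then show "rearrangement \<Omega> f t \<le> ennreal (2 * t powr (- 1 / q))"
    using \<Omega> p(1) f q t by (intro rearrangement_le_if_var_modular_le_1) auto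
qed

text \<open>With modular at most 1, the scale 1 witnesses both membership in the space and
  quasi-norm at most 1.\<close>

lemma rearrangement_le_growth_envelope_var_Lebesgue:
  assumes "f \<in> borel_measurable (lebesgue_on \<Omega>)" "var_modular \<Omega> p f \<le> 1"
  shows "rearrangement \<Omega> f t \<le> growth_envelope \<Omega> (var_Lebesgue \<Omega> p) (var_norm \<Omega> p) t"
  unfolding growth_envelope_def
proof (rule SUP_upper)
  have "var_modular \<Omega> p f < \<infinity>"
    using assms(2) by (rule le_less_trans) simp
  then have "f \<in> var_Lebesgue \<Omega> p"
    using assms(1) unfolding var_Lebesgue_def by (auto intro!: exI[of _ 1])
  moreover have "var_norm \<Omega> p f \<le> 1"
    unfolding var_norm_def using assms(2) by (intro Inf_lower) (auto intro!: exI[of _ 1])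
  ultimately show "f \<in> {f \<in> var_Lebesgue \<Omega> p. var_norm \<Omega> p f \<le> 1}"
    by simp
qed

lemma growth_envelope_var_Lebesgue_ge:
  fixes \<Omega> :: "(real ^ 'd) set"
  assumes "open \<Omega>" "x0 \<in> \<Omega>" and LH: "p \<in> LH0_at \<Omega> x0"
    and q: "0 < p x0" "AE x in lebesgue_on \<Omega>. p x0 \<le> p x"
  shows "\<exists>\<epsilon>>0. \<exists>A>0. \<forall>t. 0 < t \<and> t < \<epsilon> \<longrightarrow>
    ennreal (A * t powr (- 1 / p x0)) \<le> growth_envelope \<Omega> (var_Lebesgue \<Omega> p) (var_norm \<Omega> p) t"
proof -
  define q \<delta> v where "q = p x0" and "\<delta> = real DIM(real ^ 'd)" and "v = unit_ball_vol \<delta>"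
  have \<delta>: "\<delta> > 0" and v: "v > 0" and q0: "q > 0"
    using q by (auto simp: \<delta>_def v_def q_def)
  have \<Omega>: "\<Omega> \<in> sets lebesgue"
    using \<open>open \<Omega>\<close> by (simp add: sets_completionI_sets)
  obtain C where C: "0 < C"
    "\<And>x. x \<in> \<Omega> \<Longrightarrow> norm (x - x0) < 1/2 \<Longrightarrow> \<bar>p x - p x0\<bar> \<le> C / (- ln (norm (x - x0)))"
    using LH unfolding LH0_at_def by blast
  obtain R where R: "R > 0" "ball x0 R \<subseteq> \<Omega>"
    using assms(1,2) by (meson open_contains_ball)
  \<comment> \<open>Radii below \<open>\<rho>\<close> keep the ball inside \<open>\<Omega>\<close>
    and within the range of the log-Hoelder condition.\<close>
  define \<rho> where "\<rho> = min R (1/2)"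
  define K where "K = v * exp (C * \<delta> / q)"
  \<comment> \<open>\<open>K\<close> is the modular bound apart from the factor
    \<open>A powr q\<close>. The second argument of \<open>min\<close> makes
    \<open>A powr q * K \<le> 1\<close>; the first gives \<open>A \<le> 1\<close>, required by the
    exponent bound.\<close>
  define A where "A = min 1 (K powr (- 1 / q))"
  have K: "K > 0" and \<rho>: "\<rho> > 0"
    using v R by (auto simp: K_def \<rho>_def)
  have A: "A > 0" "A \<le> 1"
    using K by (auto simp: A_def)
  have "A powr q \<le> (K powr (- 1 / q)) powr q"
    using A q0 by (intro powr_mono2) (auto simp: A_def)
  also have "\<dots> = 1 / K"
    using K q0 by (simp add: powr_powr powr_neg_one)
  finally have AK: "A powr q * K \<le> 1"
    using K by (simp add: field_simps)
  \<comment> \<open>The factor \<open>(2 / v) powr (- 1 / q)\<close> comes from rewriting the height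
    of the test function in terms of \<open>t\<close>; the threshold on \<open>t\<close> is what
    \<open>r < \<rho>\<close> amounts to.\<close>
  have "ennreal (A * (2 / v) powr (- 1 / q) * t powr (- 1 / p x0))
      \<le> growth_envelope \<Omega> (var_Lebesgue \<Omega> p) (var_norm \<Omega> p) t"
    if t: "0 < t" "t < v * \<rho> powr \<delta> / 2" for t
  proof -
    \<comment> \<open>This radius gives the ball measure \<open>2 * t\<close>, hence strictly more
      than \<open>t\<close>, as the rearrangement bound for indicators demands.\<close>
    define r where "r = (2 * t / v) powr (1 / \<delta>)"
    have r0: "r > 0"
      using t v by (simp add: r_def)
    have "r < (\<rho> powr \<delta>) powr (1 / \<delta>)"
      unfolding r_def using t v \<delta> by (intro powr_less_mono2) (auto simp: field_simps)
    then have r: "r < \<rho>"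
      using \<rho> \<delta> by (simp add: powr_powr)
    have rd: "r powr \<delta> = 2 * t / v"
      using t v \<delta> by (simp add: r_def powr_powr)
    have B: "ball x0 r \<subseteq> \<Omega>"
      using r R(2) by (auto simp: \<rho>_def)
    define a where "a = A * r powr (- \<delta> / q)"
    have a0: "a > 0"
      using A r0 by (simp add: a_def)
    have "a = A * (r powr \<delta>) powr (- 1 / q)"
      by (simp add: a_def powr_powr)
    also have "\<dots> = A * (2 / v) powr (- 1 / q) * t powr (- 1 / q)"
      using t v unfolding rd by (simp flip: powr_mult)
    finally have a: "a = A * (2 / v) powr (- 1 / q) * t powr (- 1 / p x0)"
      by (simp add: q_def)
    have "emeasure (lebesgue_on \<Omega>) (ball x0 r) = ennreal (v * r powr \<delta>)"
      using B \<Omega> r0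
      by (simp add: emeasure_restrict_space emeasure_ball v_def \<delta>_def powr_realpow del: DIM_cart)
    also have "\<dots> = ennreal (2 * t)"
      using v by (simp add: rd)
    finally have meas: "ennreal t < emeasure (lebesgue_on \<Omega>) (ball x0 r)"
      using t by (simp add: ennreal_lessI)
    have "var_modular \<Omega> p (\<lambda>x. a * indicator (ball x0 r) x) \<le> ennreal (A powr q * K)"
      unfolding a_def K_def v_def \<delta>_def
      using \<Omega> B q C r r0 A by (intro var_modular_ball_le) (auto simp: q_def \<rho>_def)
    also have "\<dots> \<le> 1"
      using AK by (simp add: ennreal_le_1)
    finally have modular: "var_modular \<Omega> p (\<lambda>x. a * indicator (ball x0 r) x) \<le> 1" .
    have "ball x0 r \<in> sets (lebesgue_on \<Omega>)"
      using B \<Omega> by (auto simp: sets_restrict_space_iff)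
    then have "(\<lambda>x. a * indicator (ball x0 r) x) \<in> borel_measurable (lebesgue_on \<Omega>)"
      by measurable
    with modular show ?thesis
      unfolding a[symmetric]
      by (intro order_trans[OF le_rearrangement_indicator[OF a0 meas B]]
            rearrangement_le_growth_envelope_var_Lebesgue)
  qed
  moreover have "v * \<rho> powr \<delta> / 2 > 0" "A * (2 / v) powr (- 1 / q) > 0"
    using v \<rho> A by auto
  ultimately show ?thesis
    by blast
qed

theorem corollary5p18:
  fixes \<Omega> :: "(real ^ 'd) set" and p :: "real ^ 'd \<Rightarrow> real"
  assumes "open \<Omega>"
    and "p \<in> exponent_functions \<Omega>"
    and "p_plus \<Omega> p < \<infinity>"
    and "p \<in> LH0 \<Omega>"
    and "\<exists>x0\<in>\<Omega>. ereal (p x0) = p_minus \<Omega> p"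
  shows "\<exists>\<epsilon>>0. \<exists>A>0. \<exists>B>0. \<forall>t::real. 0 < t \<and> t < \<epsilon> \<longrightarrow>
    ennreal (A * t powr (- 1 / real_of_ereal (p_minus \<Omega> p)))
      \<le> growth_envelope \<Omega> (var_Lebesgue \<Omega> p) (var_norm \<Omega> p) t \<and>
    growth_envelope \<Omega> (var_Lebesgue \<Omega> p) (var_norm \<Omega> p) t
      \<le> ennreal (B * t powr (- 1 / real_of_ereal (p_minus \<Omega> p)))"
proof -
  obtain x0 where x0: "x0 \<in> \<Omega>" "p_minus \<Omega> p = ereal (p x0)"
    using assms(5) by metis
  have p: "p \<in> borel_measurable (lebesgue_on \<Omega>)" "\<And>x. x \<in> \<Omega> \<Longrightarrow> 0 < p x"
    using assms(2) by (auto simp: exponent_functions_def)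
  have \<Omega>: "\<Omega> \<in> sets lebesgue"
    using \<open>open \<Omega>\<close> by (simp add: sets_completionI_sets)
  have AE: "AE x in lebesgue_on \<Omega>. p x0 \<le> p x"
    using p(1) x0(2) by (rule AE_p_minus_le)
  have "p \<in> LH0_at \<Omega> x0"
    using assms(4) x0(1) by (simp add: LH0_def)
  from growth_envelope_var_Lebesgue_ge[OF assms(1) x0(1) this p(2)[OF x0(1)] AE]
  obtain \<epsilon> A where "\<epsilon> > 0" "A > 0" and lower: "\<And>t. 0 < t \<and> t < \<epsilon> \<Longrightarrow>
    ennreal (A * t powr (- 1 / p x0)) \<le> growth_envelope \<Omega> (var_Lebesgue \<Omega> p) (var_norm \<Omega> p) t"
    by blast
  moreover note upper = growth_envelope_var_Lebesgue_le[OF \<Omega> p p(2)[OF x0(1)] AE]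
  ultimately show ?thesis
    \<comment> \<open>The cap 1 on the range of \<open>t\<close> serves the upper bound, and
      \<open>\<epsilon>\<close> serves the lower one.\<close>
    unfolding x0(2) by (intro exI[of _ "min \<epsilon> 1"] exI[of _ A] exI[of _ 2] conjI allI impI) auto
qed

end
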